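(* For every finite group $G$, the graph $\mathcal{RP}^*(G)$ is perfect.
   Context: For a group $G$ with identity $e$, the proper reduced power graph $\mathcal{RP}^*(G)$ is the simple graph with vertex set $G\setminus\{e\}$ in which $u,v$ are adjacent if and only if $\langle v\rangle\subset\langle u\rangle$ or $\langle u\rangle\subset\langle v\rangle$, where $\subset$ means proper inclusion. A graph $\Gamma$ is perfect if for every induced subgraph $H$ of $\Gamma$, the chromatic number of $H$ equals the size of the largest clique of $H$. *)

theory Defs
  imports
    "HOL-Algebra.Generated_Groups"
    "Graph_Theory.Digraph_Component"
    "Graph_Theory.Pair_Digraph"
begin

text \<open>
  As in Graph\_Theory, a finite simple graph is a finite loop-free symmetric digraph without
  parallel arcs (locale \<^locale>\<open>graph\<close>); an edge between u and v is the pair of arcs (u, v) and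
  (v, u). The null graph is allowed; its chromatic number and its clique number are both 0.
\<close>

definition proper_coloring :: "('a, 'b) pre_digraph \<Rightarrow> nat \<Rightarrow> ('a \<Rightarrow> nat) \<Rightarrow> bool" where
  "proper_coloring G k c \<longleftrightarrow>
     (\<forall>v \<in> verts G. c v < k) \<and> (\<forall>u v. u \<rightarrow>\<^bsub>G\<^esub> v \<longrightarrow> c u \<noteq> c v)"

definition chromatic_number :: "('a, 'b) pre_digraph \<Rightarrow> nat" where
  "chromatic_number G = (LEAST k. \<exists>c. proper_coloring G k c)"

definition is_clique :: "('a, 'b) pre_digraph \<Rightarrow> 'a set \<Rightarrow> bool" where
  "is_clique G K \<longleftrightarrow> K \<subseteq> verts G \<and> (\<forall>u \<in> K. \<forall>v \<in> K. u \<noteq> v \<longrightarrow> u \<rightarrow>\<^bsub>G\<^esub> v)"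

definition clique_number :: "('a, 'b) pre_digraph \<Rightarrow> nat" where
  "clique_number G = Max {card K | K. is_clique G K}"

text \<open>
  \<^term>\<open>Max\<close> and \<^term>\<open>Least\<close> above are only meaningful for finite loop-free graphs, so
  \<^term>\<open>graph G\<close> is part of the following definition. Induced subgraphs inherit it.
\<close>

definition perfect_graph :: "('a, 'b) pre_digraph \<Rightarrow> bool" where
  "perfect_graph G \<longleftrightarrow>
     graph G \<and> (\<forall>H. induced_subgraph H G \<longrightarrow> chromatic_number H = clique_number H)"

definition proper_reduced_power_graph ::
    "('a, 'm) monoid_scheme \<Rightarrow> ('a, 'a \<times> 'a) pre_digraph" where
  "proper_reduced_power_graph G = with_proj
     \<lparr> pverts = carrier G - {\<one>\<^bsub>G\<^esub>},
       parcs = {(u, v). u \<in> carrier G - {\<one>\<^bsub>G\<^esub>} \<and> v \<in> carrier G - {\<one>\<^bsub>G\<^esub>} \<and>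
         (generate G {v} \<subset> generate G {u} \<or> generate G {u} \<subset> generate G {v})} \<rparr>"

end

theory Submission
  imports Defs
begin

text \<open>
  The reduced power graph is a comparability graph: two vertices are adjacent iff they are
  comparable in the strict partial order in which \<open>u\<close> lies below \<open>v\<close> when \<open>u\<close> generates a proper
  subgroup of the group generated by \<open>v\<close>. Comparability graphs of finite strict partial orders
  are perfect. An induced subgraph is again a comparability graph of the same order, so it suffices
  to show that the chromatic number and the clique number agree for one such graph \<open>H\<close>. The former
  is at least the latter in every graph, since a proper colouring is injective on a clique
  (\<open>card_clique_le_colors\<close>). Conversely, colour \<open>v\<close> by its height, the size of a
  largest clique of \<open>H\<close> that lies strictly below \<open>v\<close>. Adding \<open>v\<close> to that clique gives a larger
  clique, so heights are smaller than the clique number (\<open>height_less_clique_number\<close>), and the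
  larger clique lies below everything above \<open>v\<close>, so comparable vertices get different heights
  (\<open>height_strict_mono\<close>).
\<close>

section \<open>Cliques and colourings of finite graphs\<close>

lemma finite_clique_cards:
  assumes "finite (verts H)"
  shows "finite {card K | K. is_clique H K \<and> P K}"
proof (rule finite_subset)
  show "{card K | K. is_clique H K \<and> P K} \<subseteq> card ` Pow (verts H)"
    by (auto simp: is_clique_def)
qed (use assms in simp)

lemma is_clique_empty: "is_clique H {}"
  by (simp add: is_clique_def)

lemma finite_clique: "finite (verts H) \<Longrightarrow> is_clique H K \<Longrightarrow> finite K"
  by (auto simp: is_clique_def intro: finite_subset)

lemma card_clique_le_clique_number:
  assumes "finite (verts H)" "is_clique H K"
  shows "card K \<le> clique_number H"
  unfolding clique_number_def
  using finite_clique_cards[OF assms(1), of "\<lambda>_. True"] assms(2) by (auto intro: Max_ge)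

lemma clique_number_attained:
  assumes "finite (verts H)"
  obtains K where "is_clique H K" "card K = clique_number H"
proof -
  have "clique_number H \<in> {card K | K. is_clique H K}"
    unfolding clique_number_def
    using finite_clique_cards[OF assms, of "\<lambda>_. True"] is_clique_empty[of H]
    by (intro Max_in) auto
  then show ?thesis using that by auto
qed

lemma card_clique_le_colors:
  assumes "proper_coloring H k c" "is_clique H K"
  shows "card K \<le> k"
proof -
  have "inj_on c K"
    using assms unfolding proper_coloring_def is_clique_def inj_on_def by metis
  moreover have "c ` K \<subseteq> {..<k}"
    using assms by (auto simp: proper_coloring_def is_clique_def)
  ultimately show ?thesis
    using card_inj_on_le[of c K "{..<k}"] by simp
qed

lemma chromatic_number_eq_clique_number:
  assumes "finite (verts H)" "proper_coloring H (clique_number H) c"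
  shows "chromatic_number H = clique_number H"
  unfolding chromatic_number_def
proof (rule Least_equality)
  show "\<exists>c. proper_coloring H (clique_number H) c"
    using assms(2) by blast
next
  fix k assume "\<exists>c. proper_coloring H k c"
  then show "clique_number H \<le> k"
    by (metis assms(1) clique_number_attained card_clique_le_colors)
qed

section \<open>Comparability graphs\<close>

text \<open>
  The size of a largest clique of \<open>H\<close> all of whose elements are strictly below \<open>v\<close>; minimal
  vertices have height 0.
\<close>

definition height :: "('a \<Rightarrow> 'a \<Rightarrow> bool) \<Rightarrow> ('a, 'b) pre_digraph \<Rightarrow> 'a \<Rightarrow> nat" where
  "height r H v = Max {card K | K. is_clique H K \<and> (\<forall>u \<in> K. r u v)}"

text \<open>
  The locale describes the comparability graph of a strict partial order \<open>r\<close>, restricted to a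
  finite set of vertices.
\<close>

locale comparability_graph =
  fixes H :: "('a, 'b) pre_digraph" and r :: "'a \<Rightarrow> 'a \<Rightarrow> bool"
  assumes finite_verts: "finite (verts H)"
    and irrefl: "\<not> r v v"
    and trans: "r u v \<Longrightarrow> r v w \<Longrightarrow> r u w"
    and adj_iff: "u \<rightarrow>\<^bsub>H\<^esub> v \<longleftrightarrow> u \<in> verts H \<and> v \<in> verts H \<and> (r u v \<or> r v u)"
begin

lemma card_le_height:
  assumes "is_clique H K" "\<forall>u \<in> K. r u v"
  shows "card K \<le> height r H v"
  unfolding height_def
  using finite_clique_cards[OF finite_verts, of "\<lambda>K. \<forall>u \<in> K. r u v"] assms
  by (auto intro: Max_ge)

lemma height_attained:
  obtains K where "is_clique H K" "\<forall>u \<in> K. r u v" "card K = height r H v"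
proof -
  have "height r H v \<in> {card K | K. is_clique H K \<and> (\<forall>u \<in> K. r u v)}"
    unfolding height_def
    using finite_clique_cards[OF finite_verts] is_clique_empty[of H]
    by (intro Max_in) auto
  then show ?thesis using that by auto
qed

lemma clique_of_card_Suc_height:
  assumes "v \<in> verts H"
  obtains K where "is_clique H (insert v K)" "\<forall>u \<in> K. r u v"
    "card (insert v K) = Suc (height r H v)"
proof -
  obtain K where K: "is_clique H K" "\<forall>u \<in> K. r u v" "card K = height r H v"
    by (rule height_attained)
  have "is_clique H (insert v K)"
    using K(1,2) assms by (auto simp: is_clique_def adj_iff)
  moreover have "v \<notin> K"
    using K(2) irrefl by blast
  ultimately show ?thesis
    using that K finite_clique[OF finite_verts K(1)] by simp
qed

lemma height_less_clique_number:
  assumes "v \<in> verts H"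
  shows "height r H v < clique_number H"
  using clique_of_card_Suc_height[OF assms] card_clique_le_clique_number[OF finite_verts]
  by (metis Suc_le_lessD)

lemma height_strict_mono:
  assumes "v \<in> verts H" "r v w"
  shows "height r H v < height r H w"
proof -
  obtain K where K: "is_clique H (insert v K)" "\<forall>u \<in> K. r u v"
      "card (insert v K) = Suc (height r H v)"
    using clique_of_card_Suc_height[OF assms(1)] .
  have "\<forall>u \<in> insert v K. r u w"
    using K(2) assms(2) trans by blast
  then show ?thesis
    using card_le_height[OF K(1), of w] K(3) by linarith
qed

lemma chromatic_number_eq: "chromatic_number H = clique_number H"
proof (rule chromatic_number_eq_clique_number[OF finite_verts])
  show "proper_coloring H (clique_number H) (height r H)"
    unfolding proper_coloring_def
    using height_less_clique_number height_strict_mono by (fastforce simp: adj_iff)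
qed

lemma induced:
  assumes "induced_subgraph K H"
  shows "comparability_graph K r"
proof
  show "finite (verts K)"
    using assms finite_verts by (auto simp: induced_subgraph_def subgraph_def intro: finite_subset)
  have sub: "verts K \<subseteq> verts H"
    using assms by (simp add: induced_subgraph_def subgraph_def)
  have "u \<rightarrow>\<^bsub>K\<^esub> v \<longleftrightarrow> u \<in> verts K \<and> v \<in> verts K \<and> u \<rightarrow>\<^bsub>H\<^esub> v" for u v
    using assms
    by (auto simp: induced_subgraph_def subgraph_def compatible_def arcs_ends_conv)
  then show "u \<rightarrow>\<^bsub>K\<^esub> v \<longleftrightarrow> u \<in> verts K \<and> v \<in> verts K \<and> (r u v \<or> r v u)" for u v
    using sub by (auto simp: adj_iff)
qed (use irrefl trans in blast)+

lemma perfect: "graph H \<Longrightarrow> perfect_graph H"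
  unfolding perfect_graph_def
  using comparability_graph.chromatic_number_eq[OF induced] by blast

end

section \<open>The reduced power graph\<close>

lemma graph_proper_reduced_power_graph:
  assumes "finite (carrier G)"
  shows "graph (proper_reduced_power_graph G)"
proof -
  let ?V = "carrier G - {\<one>\<^bsub>G\<^esub>}"
  let ?E = "{(u, v). u \<in> ?V \<and> v \<in> ?V \<and>
    (generate G {v} \<subset> generate G {u} \<or> generate G {u} \<subset> generate G {v})}"
  have "finite ?E"
    by (rule finite_subset[of _ "?V \<times> ?V"]) (use assms in auto)
  then interpret pair_graph "\<lparr> pverts = ?V, parcs = ?E \<rparr>"
    using assms by unfold_locales (auto simp: symmetric_def sym_def)
  show ?thesis
    unfolding proper_reduced_power_graph_def by (rule graph_axioms)
qed

theorem corollary3p1: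
  fixes G :: "('a, 'm) monoid_scheme"
  assumes "group G"
    and "finite (carrier G)"
  shows "perfect_graph (proper_reduced_power_graph G)"
proof -
  interpret comparability_graph "proper_reduced_power_graph G"
    "\<lambda>u v. generate G {u} \<subset> generate G {v}"
    by unfold_locales (use assms(2) in \<open>auto simp: proper_reduced_power_graph_def\<close>)
  show ?thesis
    using graph_proper_reduced_power_graph[OF assms(2)] by (rule perfect)
qed

end
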